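(* A score function $f:\mathcal{X}\to\mathbb{R}^C$ is $\mathsf{AUTKC}$ Bayes optimal, i.e. $f\in\arg\inf_{g}\mathcal{R}_K(g)$, if and only if the score is top-$K$ ranking-preserving with respect to the conditional probability, i.e. $\mathsf{RP}_K(f(\boldsymbol{x}),\eta(\boldsymbol{x}))$. More concretely, we have $$f(\boldsymbol{x})_{y_1}>f(\boldsymbol{x})_{y_2}\quad\text{if}\quad \eta(\boldsymbol{x})_{y_1}>\eta(\boldsymbol{x})_{y_2}\ge\eta(\boldsymbol{x})_{[K]}.$$
   Context: $\mathcal{X}$ is the input space, $\mathcal{Y}=\{1,\dots,C\}$ is the label space, $\mathcal{D}$ is a probability distribution on $\mathcal{X}\times\mathcal{Y}$, and $\eta(\boldsymbol{x})_y=\mathbb{P}[y\mid\boldsymbol{x}]$; $\boldsymbol{x}$ stands for any given input and $y_1,y_2$ for labels. The positive integer $K$ is a hyperparameter. It is assumed that there are no ties in $\eta(\boldsymbol{x})\in\mathbb{R}^C$, i.e. $\eta(\boldsymbol{x})_{[1]}>\cdots>\eta(\boldsymbol{x})_{[C]}$, where $a_{[k]}$ denotes the $k$-th greatest entry of a vector $\boldsymbol{a}$. For a vector $\boldsymbol{s}\in\mathbb{R}^C$, $\pi_{\boldsymbol{s}}(y)\in\{1,\dots,C\}$ is the position of $s_y$ when $\boldsymbol{s}$ is sorted in descending order. Ties in $f(\boldsymbol{x})$ may exist and are assumed to be wrongly broken: if $\eta(\boldsymbol{x})_{y_1}>\eta(\boldsymbol{x})_{y_2}$ and $f(\boldsymbol{x})_{y_1}=f(\boldsymbol{x})_{y_2}$,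 then $\pi_{f(\boldsymbol{x})}(y_1)>\pi_{f(\boldsymbol{x})}(y_2)$. The $\mathsf{AUTKC}$ risk of a score function $f$ is $\mathcal{R}_K(f)=\mathbb{E}_{(\boldsymbol{x},y)\sim\mathcal{D}}\big[\frac1K\sum_{k=1}^K\mathbf{1}[\pi_{f(\boldsymbol{x})}(y)>k]\big]$, and the infimum is over score functions $g:\mathcal{X}\to\mathbb{R}^C$. Top-$K$ ranking-preserving: for $\boldsymbol{a},\boldsymbol{b}\in\mathbb{R}^C$, $\boldsymbol{b}$ is top-$K$ ranking-preserving with respect to $\boldsymbol{a}$, written $\mathsf{RP}_K(\boldsymbol{b},\boldsymbol{a})$, if for any $k\le K$, $\pi_{\boldsymbol{b}}(y)=k\Rightarrow\pi_{\boldsymbol{a}}(y)=k$.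
   Formalization: Ranking preservation and the concrete inequality are asserted for almost every input x, since changing f on a null set of inputs keeps it Bayes optimal; score functions are taken measurable, and the concrete inequality is stated for K ≤ C, where the K-th greatest entry exists. *)

theory Defs
  imports "HOL-Probability.Probability" "HOL-Library.Multiset"
begin

text \<open>Labels are the elements of a finite type \<^typ>\<open>'c\<close>, so the number of classes is
  \<^term>\<open>CARD('c)\<close> and score vectors live in \<^typ>\<open>real ^ 'c\<close>. Inputs form a measurable space
  \<open>M\<close>, of which only the sigma-algebra is used, and score functions are the elements of
  \<open>borel_measurable M\<close>.\<close>

text \<open>The \<open>k\<close>-th greatest entry (counted with multiplicity), for \<open>1 \<le> k \<le> CARD('c)\<close>.\<close>

definition kth_greatest :: "real ^ 'c::finite \<Rightarrow> nat \<Rightarrow> real" where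
  "kth_greatest a k = rev (sorted_list_of_multiset {#a $ y. y \<in># mset_set UNIV#}) ! (k - 1)"

definition no_ties :: "real ^ 'c::finite \<Rightarrow> bool" where
  "no_ties a \<longleftrightarrow> (\<forall>k\<in>{1..<CARD('c)}. kth_greatest a k > kth_greatest a (k + 1))"

text \<open>\<open>position e s y\<close> is the one-based position of \<open>s $ y\<close> when \<open>s\<close> is sorted in descending
  order. Ties in \<open>s\<close> are broken wrongly with respect to \<open>e\<close>: among equal scores, the labels with
  smaller \<open>e\<close> come first. Label \<open>y\<close> itself is among the labels counted. The lemmas
  \<open>position_*\<close> below show that this is the only ranking of the labels compatible with \<open>s\<close> and
  with this tie-breaking rule.\<close>

definition position :: "real ^ 'c::finite \<Rightarrow> real ^ 'c \<Rightarrow> 'c \<Rightarrow> nat" where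
  "position e s y = card {y'. s $ y' > s $ y \<or> s $ y' = s $ y \<and> e $ y' \<le> e $ y}"

text \<open>The tie-breaking for \<open>b\<close> refers to the reference vector \<open>a\<close>.\<close>

definition top_ranking_preserving :: "nat \<Rightarrow> real ^ 'c::finite \<Rightarrow> real ^ 'c \<Rightarrow> bool" where
  "top_ranking_preserving K b a \<longleftrightarrow>
     (\<forall>k\<le>K. \<forall>y. position a b y = k \<longrightarrow> position a a y = k)"

text \<open>\<open>\<eta> x $ y\<close> is a version of the conditional probability of label \<open>y\<close> given the input, i.e. of
  the conditional expectation of the indicator of label \<open>y\<close> with respect to the sigma-algebra
  generated by the input coordinate.\<close>

definition label_cond_prob ::
    "'x measure \<Rightarrow> ('x \<times> 'c::finite) measure \<Rightarrow> ('x \<Rightarrow> real ^ 'c) \<Rightarrow> bool" where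
  "label_cond_prob M D \<eta> \<longleftrightarrow> \<eta> \<in> borel_measurable M \<and>
     (\<forall>y. AE z in D. \<eta> (fst z) $ y =
        real_cond_exp D (vimage_algebra (space D) fst M) (\<lambda>z. indicator {y} (snd z)) z)"

definition autkc_risk ::
    "nat \<Rightarrow> ('x \<times> 'c::finite) measure \<Rightarrow> ('x \<Rightarrow> real ^ 'c) \<Rightarrow> ('x \<Rightarrow> real ^ 'c) \<Rightarrow> real" where
  "autkc_risk K D \<eta> f =
     (\<integral>(x, y). 1 / real K * (\<Sum>k=1..K. of_bool (position (\<eta> x) (f x) y > k)) \<partial>D)"

definition autkc_bayes_optimal ::
    "nat \<Rightarrow> 'x measure \<Rightarrow> ('x \<times> 'c::finite) measure \<Rightarrow> ('x \<Rightarrow> real ^ 'c) \<Rightarrow>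
     ('x \<Rightarrow> real ^ 'c) \<Rightarrow> bool" where
  "autkc_bayes_optimal K M D \<eta> f \<longleftrightarrow> f \<in> borel_measurable M \<and>
     autkc_risk K D \<eta> f = (INF g\<in>borel_measurable M. autkc_risk K D \<eta> g)"

lemma position_less_if_greater:
  assumes "s $ y1 > s $ y2"
  shows "position e s y1 < position e s y2"
  unfolding position_def
  by (rule psubset_card_mono) (use assms in \<open>auto simp: set_eq_iff intro!: exI[of _ y2]\<close>)

lemma position_greater_if_tie:
  assumes "e $ y1 > e $ y2" "s $ y1 = s $ y2"
  shows "position e s y1 > position e s y2"
  unfolding position_def
  by (rule psubset_card_mono) (use assms in \<open>auto simp: set_eq_iff dest!: spec[of _ y1]\<close>)

lemma inj_position:
  assumes "inj (($) e)"
  shows "inj (position e s)"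
proof (rule injI, rule ccontr)
  fix y1 y2 assume eq: "position e s y1 = position e s y2" and "y1 \<noteq> y2"
  then have "e $ y1 \<noteq> e $ y2" using assms by (auto dest: injD)
  then show False
    using eq position_less_if_greater[of s y1 y2 e] position_less_if_greater[of s y2 y1 e]
      position_greater_if_tie[of e y1 y2 s] position_greater_if_tie[of e y2 y1 s]
    by (metis less_irrefl linorder_less_linear)
qed

lemma position_bij_betw:
  fixes e s :: "real ^ 'c::finite"
  assumes "inj (($) e)"
  shows "bij_betw (position e s) UNIV {1..CARD('c)}"
proof -
  have "position e s y \<in> {1..CARD('c)}" for y
    unfolding position_def by (auto simp: Suc_le_eq card_gt_0_iff intro!: card_mono)
  then have "range (position e s) = {1..CARD('c)}"
    by (intro card_subset_eq) (auto simp: card_image inj_position[OF assms])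
  then show ?thesis by (simp add: bij_betw_def inj_position[OF assms])
qed

lemma position_unique:
  fixes e s :: "real ^ 'c::finite"
  assumes "inj (($) e)" and bij: "bij_betw p UNIV {1..CARD('c)}"
    and gt: "\<And>y1 y2. s $ y1 > s $ y2 \<Longrightarrow> p y1 < p y2"
    and tie: "\<And>y1 y2. e $ y1 > e $ y2 \<Longrightarrow> s $ y1 = s $ y2 \<Longrightarrow> p y1 > p y2"
  shows "p = position e s"
proof
  fix y
  have inj: "inj p" using bij by (simp add: bij_betw_def)
  have "{y'. s $ y' > s $ y \<or> s $ y' = s $ y \<and> e $ y' \<le> e $ y} = {y'. p y' \<le> p y}"
  proof (intro Collect_cong iffI)
    fix y' assume "s $ y' > s $ y \<or> s $ y' = s $ y \<and> e $ y' \<le> e $ y"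
    then show "p y' \<le> p y"
      using gt tie assms(1)
      by (metis (no_types, lifting) injD linorder_le_less_linear order_le_less)
  next
    fix y' assume "p y' \<le> p y"
    then show "s $ y' > s $ y \<or> s $ y' = s $ y \<and> e $ y' \<le> e $ y"
      using gt[where ?y1.0 = y and ?y2.0 = y'] tie[where ?y1.0 = y' and ?y2.0 = y]
      by (metis (no_types) linorder_not_le linorder_less_linear)
  qed
  then have "position e s y = card (p ` {y'. p y' \<le> p y})"
    unfolding position_def by (simp add: card_image inj_on_subset[OF inj])
  also have "p ` {y'. p y' \<le> p y} = {1..p y}"
    using bij unfolding bij_betw_def
    by (auto simp: set_eq_iff image_iff) (metis order_trans)+
  finally show "p y = position e s y" by simp
qed

lemma no_ties_iff_inj:
  fixes a :: "real ^ 'c::finite"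
  shows "no_ties a \<longleftrightarrow> inj (($) a)"
proof -
  define A where "A = {#a $ y. y \<in># mset_set UNIV#}"
  define xs where "xs = sorted_list_of_multiset A"
  define n where "n = CARD('c)"
  have mset: "mset xs = A" by (simp add: xs_def)
  have len: "length xs = n"
    using arg_cong[OF mset, of size] by (simp add: A_def n_def)
  have "no_ties a \<longleftrightarrow> (\<forall>i. Suc i < length (rev xs) \<longrightarrow> rev xs ! i > rev xs ! Suc i)"
  proof -
    have "(\<forall>k\<in>{1..<n}. P (k - 1)) \<longleftrightarrow> (\<forall>i. Suc i < n \<longrightarrow> P i)" for P
      by (metis One_nat_def Suc_le_mono Suc_pred atLeastLessThan_iff diff_Suc_1 le0 less_eq_Suc_le)
    from this[of "\<lambda>i. rev xs ! i > rev xs ! Suc i"] show ?thesis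
      unfolding no_ties_def kth_greatest_def A_def[symmetric] xs_def[symmetric] n_def[symmetric]
      by (simp add: len)
  qed
  also have "\<dots> \<longleftrightarrow> sorted_wrt (>) (rev xs)"
    by (subst sorted_wrt_iff_nth_Suc_transp) (auto intro: transpI)
  also have "\<dots> \<longleftrightarrow> distinct xs"
    by (simp add: sorted_wrt_rev xs_def strict_sorted_iff)
  also have "\<dots> \<longleftrightarrow> card (range (($) a)) = n"
  proof -
    have "set xs = range (($) a)" using arg_cong[OF mset, of set_mset] by (simp add: A_def)
    then show ?thesis using len by (metis card_distinct distinct_card)
  qed
  also have "\<dots> \<longleftrightarrow> inj (($) a)"
    by (auto simp: n_def card_image intro: eq_card_imp_inj_on)
  finally show ?thesis .
qed

end

theory Submission imports Defs begin

text \<open>Conditioning on the input turns the risk of \<open>f\<close> into the expectation of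
  \<open>1/K \<Sum>k=1..K (\<Sum>y \<eta>\<^sub>y - \<Sum>y\<in>T\<^sub>k \<eta>\<^sub>y)\<close>, where \<open>T\<^sub>k\<close> is the set of the \<open>k\<close> labels ranked first by
  \<open>f x\<close>. Each inner term is minimal exactly when \<open>T\<^sub>k\<close> consists of the \<open>k\<close> labels with largest
  conditional probability. The score \<open>\<eta>\<close> attains all these minima at once, so \<open>f\<close> is optimal iff
  almost surely all \<open>T\<^sub>k\<close> with \<open>k \<le> K\<close> are the right ones, which is top-\<open>K\<close> ranking preservation.\<close>

section \<open>Regret at a single input\<close>

lemma position_ge_1: "1 \<le> position e s y"
  unfolding position_def by (auto simp: Suc_le_eq card_gt_0_iff)

text \<open>The right-hand side is free of \<open>s\<close>: top-\<open>k\<close> sets of any two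
  scores have equal size, so an inclusion between them is an equality. The \<open>min\<close> covers
  \<open>k\<close> beyond the number of classes.\<close>

lemma card_position_le:
  fixes e s :: "real ^ 'c::finite"
  assumes "inj (($) e)"
  shows "card {y. position e s y \<le> k} = min k CARD('c)"
proof -
  have "range (position e s) = {1..CARD('c)}"
    using position_bij_betw[OF assms] by (rule bij_betw_imp_surj_on)
  moreover have "position e s ` {y. position e s y \<le> k} = range (position e s) \<inter> {..k}"
    by auto
  ultimately have "position e s ` {y. position e s y \<le> k} = {1..CARD('c)} \<inter> {..k}"
    by simp
  also have "\<dots> = {1..min k CARD('c)}" by auto
  finally have image: "position e s ` {y. position e s y \<le> k} = {1..min k CARD('c)}" .
  have "card {y. position e s y \<le> k} = card (position e s ` {y. position e s y \<le> k})"
    by (rule card_image[symmetric]) (rule inj_on_subset[OF inj_position[OF assms] subset_UNIV])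
  then show ?thesis by (simp only: image card_atLeastAtMost diff_Suc_1 Suc_eq_plus1[symmetric])
qed

lemma position_self: "position a a y = card {y'. a $ y \<le> a $ y'}"
  unfolding position_def by (rule arg_cong[where f = card]) auto

lemma position_self_le_iff: "position a a y1 \<le> position a a y2 \<longleftrightarrow> a $ y2 \<le> a $ y1"
proof
  assume "position a a y1 \<le> position a a y2"
  then show "a $ y2 \<le> a $ y1"
    by (metis linorder_not_le position_less_if_greater)
next
  assume "a $ y2 \<le> a $ y1"
  then show "position a a y1 \<le> position a a y2"
    unfolding position_self by (intro card_mono) auto
qed

section \<open>Maximal mass among sets of equal size\<close>

text \<open>\<open>B\<close> is a superlevel set of \<open>e\<close>. Equal sizes allow
  \<open>t\<close> to be subtracted from every weight without changing the difference of the sums;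
  then labels in \<open>B\<close> weigh nonnegatively and all others strictly negatively.\<close>

lemma sum_diff_threshold:
  fixes e :: "'a::finite \<Rightarrow> real"
  assumes "card A = card B" and "\<And>y. y \<in> B \<Longrightarrow> t \<le> e y" and "\<And>y. y \<notin> B \<Longrightarrow> e y < t"
  shows "sum e A \<le> sum e B" and "sum e A = sum e B \<longleftrightarrow> A = B"
proof -
  \<comment> \<open>The contribution of \<open>y\<close> to the shifted difference; its two factors
    never have opposite signs.\<close>
  define g where "g y = (e y - t) * (of_bool (y \<in> B) - of_bool (y \<in> A))" for y
  have g: "0 \<le> g y" for y
    using assms(2,3)[of y] by (auto simp: g_def)
  have "(\<Sum>y\<in>UNIV. g y) = (\<Sum>y\<in>B. e y - t) - (\<Sum>y\<in>A. e y - t)"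
  proof -
    have "(\<Sum>y\<in>UNIV. (e y - t) * of_bool (y \<in> S)) = (\<Sum>y\<in>S. e y - t)" for S
      by (simp add: of_bool_def if_distrib[of "\<lambda>x. _ * x"] sum.If_cases cong: if_cong)
    then show ?thesis by (simp add: g_def right_diff_distrib sum_subtractf)
  qed
  also have "\<dots> = sum e B - sum e A"
    using assms(1) by (simp add: sum_subtractf)
  finally have eq: "sum e B - sum e A = (\<Sum>y\<in>UNIV. g y)" by simp
  then show "sum e A \<le> sum e B"
    using sum_nonneg[of UNIV g] g by simp
  show "sum e A = sum e B \<longleftrightarrow> A = B"
  proof
    assume "sum e A = sum e B"
    then have "(\<Sum>y\<in>UNIV. g y) = 0" using eq by simp
    then have "g y = 0" for y
      using g by (simp add: sum_nonneg_eq_0_iff)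
    \<comment> \<open>A label of \<open>A\<close> outside \<open>B\<close> would make
      \<open>g y\<close> a product of two negative factors.\<close>
    then have "y \<in> B" if "y \<in> A" for y
      using assms(3)[of y] that by (fastforce simp: g_def)
    then show "A = B"
      using assms(1) by (intro card_subset_eq) auto
  qed simp
qed

lemma sum_position_le:
  fixes e s :: "real ^ 'c::finite"
  assumes "inj (($) e)" and "1 \<le> k"
  defines "A \<equiv> {y. position e s y \<le> k}" and "B \<equiv> {y. position e e y \<le> k}"
  shows "(\<Sum>y\<in>A. e $ y) \<le> (\<Sum>y\<in>B. e $ y)"
    and "(\<Sum>y\<in>A. e $ y) = (\<Sum>y\<in>B. e $ y) \<longleftrightarrow> A = B"
proof -
  have card: "card A = card B"
    unfolding A_def B_def by (simp add: card_position_le[OF assms(1)])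
  have "card B \<noteq> 0"
    using assms(2) unfolding B_def by (simp add: card_position_le[OF assms(1)])
  then have "B \<noteq> {}" by auto
  \<comment> \<open>The threshold is the smallest value of \<open>e\<close> on \<open>B\<close>,
    which is nonempty because \<open>1 \<le> k\<close>. Labels outside \<open>B\<close> are ranked
    after the minimiser \<open>y0\<close>, hence lie strictly below \<open>t\<close>.\<close>
  define t where "t = Min (($) e ` B)"
  have "t \<in> ($) e ` B" unfolding t_def using \<open>B \<noteq> {}\<close> by (intro Min_in) auto
  then obtain y0 where y0: "y0 \<in> B" "t = e $ y0" by auto
  have 1: "t \<le> e $ y" if "y \<in> B" for y
    unfolding t_def using that by (intro Min_le) auto
  have 2: "e $ y < t" if "y \<notin> B" for y
    using that y0 position_self_le_iff[of e y y0] unfolding B_def by auto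
  show "(\<Sum>y\<in>A. e $ y) \<le> (\<Sum>y\<in>B. e $ y)"
    and "(\<Sum>y\<in>A. e $ y) = (\<Sum>y\<in>B. e $ y) \<longleftrightarrow> A = B"
    using sum_diff_threshold[where e = "($) e" and A = A and B = B and t = t] card 1 2 by auto
qed

section \<open>Conditional risk and regret\<close>

text \<open>The integrand of the risk as a function of the position alone. For \<open>K > 0\<close>
  and \<open>p \<ge> 1\<close> it is the truncated rank \<open>min (p - 1) K / K\<close>.\<close>

definition autkc_loss :: "nat \<Rightarrow> nat \<Rightarrow> real" where
  "autkc_loss K p = 1 / real K * (\<Sum>k=1..K. of_bool (p > k))"

text \<open>The expected loss given the input, with \<open>e\<close> in the role of
  \<open>\<eta> x\<close> and \<open>s\<close> in that of \<open>f x\<close>; \<open>e\<close>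
  serves both as label weights and as tie-breaker.\<close>

definition cond_autkc_risk :: "nat \<Rightarrow> real ^ 'c::finite \<Rightarrow> real ^ 'c \<Rightarrow> real" where
  "cond_autkc_risk K e s = (\<Sum>y\<in>UNIV. autkc_loss K (position e s y) * e $ y)"

text \<open>Swapping the sums and passing to complements makes the score enter only through the
  masses of its top-\<open>k\<close> sets.\<close>

lemma cond_autkc_risk_alt:
  "cond_autkc_risk K e s =
     1 / real K * (\<Sum>k=1..K. (\<Sum>y\<in>UNIV. e $ y) - (\<Sum>y | position e s y \<le> k. e $ y))"
proof -
  have "cond_autkc_risk K e s =
      1 / real K * (\<Sum>y\<in>UNIV. \<Sum>k=1..K. of_bool (position e s y > k) * e $ y)"
    unfolding cond_autkc_risk_def autkc_loss_def
    by (simp add: sum_distrib_right sum_distrib_left mult.assoc)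
  also have "(\<Sum>y\<in>UNIV. \<Sum>k=1..K. of_bool (position e s y > k) * e $ y) =
      (\<Sum>k=1..K. \<Sum>y\<in>UNIV. of_bool (position e s y > k) * e $ y)"
    by (rule sum.swap)
  also have "\<dots> = (\<Sum>k=1..K. (\<Sum>y\<in>UNIV. e $ y) - (\<Sum>y | position e s y \<le> k. e $ y))"
  proof (rule sum.cong[OF refl])
    fix k
    have "(\<Sum>y\<in>UNIV. of_bool (position e s y > k) * e $ y) =
        (\<Sum>y\<in>UNIV - {y. position e s y \<le> k}. e $ y)"
      by (rule sum.mono_neutral_cong_right) auto
    then show "(\<Sum>y\<in>UNIV. of_bool (position e s y > k) * e $ y) =
        (\<Sum>y\<in>UNIV. e $ y) - (\<Sum>y | position e s y \<le> k. e $ y)"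
      by (simp add: sum_diff)
  qed
  finally show ?thesis .
qed

text \<open>Forwards, preservation gives inclusion of the top-\<open>k\<close> sets, and equal size
  does the rest. Backwards, a label has position \<open>k\<close> exactly when it lies in the
  \<open>k\<close>-th set but not in the one before.\<close>

lemma top_ranking_preserving_iff:
  fixes e s :: "real ^ 'c::finite"
  assumes "inj (($) e)"
  shows "top_ranking_preserving K s e \<longleftrightarrow>
    (\<forall>k\<in>{1..K}. {y. position e s y \<le> k} = {y. position e e y \<le> k})"
proof
  assume rp: "top_ranking_preserving K s e"
  show "\<forall>k\<in>{1..K}. {y. position e s y \<le> k} = {y. position e e y \<le> k}"
  proof
    fix k assume k: "k \<in> {1..K}"
    have "{y. position e s y \<le> k} \<subseteq> {y. position e e y \<le> k}"
      using rp k unfolding top_ranking_preserving_def by (auto dest: order_trans)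
    then show "{y. position e s y \<le> k} = {y. position e e y \<le> k}"
      by (intro card_subset_eq) (auto simp: card_position_le[OF assms])
  qed
next
  assume eq: "\<forall>k\<in>{1..K}. {y. position e s y \<le> k} = {y. position e e y \<le> k}"
  \<comment> \<open>Level 0, where both sides fail because positions start at 1, is added to serve
    as the predecessor of level 1.\<close>
  have eq0: "position e s y \<le> k \<longleftrightarrow> position e e y \<le> k" if "k \<le> K" for y k
  proof (cases "k = 0")
    case True
    then show ?thesis using position_ge_1[of e s y] position_ge_1[of e e y] by simp
  next
    case False
    then show ?thesis using bspec[OF eq, of k] that by auto
  qed
  show "top_ranking_preserving K s e"
    unfolding top_ranking_preserving_def
  proof (intro allI impI)
    fix k y assume k: "k \<le> K" and y: "position e s y = k"
    have "1 \<le> k" using y position_ge_1[of e s y] by simp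
    moreover have "position e e y \<le> k" using eq0[of k y] k y by simp
    moreover have "\<not> position e e y \<le> k - 1" using eq0[of "k - 1" y] k y \<open>1 \<le> k\<close> by linarith
    ultimately show "position e e y = k" by simp
  qed
qed

text \<open>The regret is the average of the \<open>K\<close> mass deficits \<open>r k\<close>; all
  are nonnegative, so it vanishes only if each of them does.\<close>

lemma cond_autkc_risk_regret:
  fixes e s :: "real ^ 'c::finite"
  assumes "inj (($) e)" and "K > 0"
  shows "cond_autkc_risk K e e \<le> cond_autkc_risk K e s"
    and "cond_autkc_risk K e s = cond_autkc_risk K e e \<longleftrightarrow> top_ranking_preserving K s e"
proof -
  define r where "r k = (\<Sum>y | position e e y \<le> k. e $ y) - (\<Sum>y | position e s y \<le> k. e $ y)" for k
  have diff: "cond_autkc_risk K e s - cond_autkc_risk K e e = 1 / real K * (\<Sum>k=1..K. r k)"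
    unfolding cond_autkc_risk_alt r_def
    by (simp add: right_diff_distrib[symmetric] diff_divide_distrib[symmetric] sum_subtractf)
  have r: "0 \<le> r k" if "k \<in> {1..K}" for k
    using sum_position_le(1)[OF assms(1), of k s] that by (simp add: r_def)
  then have "0 \<le> 1 / real K * (\<Sum>k=1..K. r k)"
    by (intro mult_nonneg_nonneg sum_nonneg) auto
  then show "cond_autkc_risk K e e \<le> cond_autkc_risk K e s"
    using diff by simp
  have "cond_autkc_risk K e s = cond_autkc_risk K e e \<longleftrightarrow> (\<Sum>k=1..K. r k) = 0"
    using diff \<open>K > 0\<close> by auto
  also have "\<dots> \<longleftrightarrow> (\<forall>k\<in>{1..K}. r k = 0)"
    using r by (intro sum_nonneg_eq_0_iff) auto
  also have "\<dots> \<longleftrightarrow> top_ranking_preserving K s e"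
    unfolding top_ranking_preserving_iff[OF assms(1)]
  proof (rule ball_cong[OF refl])
    fix k assume "k \<in> {1..K}"
    then have "(\<Sum>y | position e s y \<le> k. e $ y) = (\<Sum>y | position e e y \<le> k. e $ y) \<longleftrightarrow>
        {y. position e s y \<le> k} = {y. position e e y \<le> k}"
      by (intro sum_position_le(2)[OF assms(1)]) simp
    then show "r k = 0 \<longleftrightarrow> {y. position e s y \<le> k} = {y. position e e y \<le> k}"
      unfolding r_def right_minus_eq by metis
  qed
  finally show "cond_autkc_risk K e s = cond_autkc_risk K e e \<longleftrightarrow> top_ranking_preserving K s e" .
qed

section \<open>Strict order among the largest conditional probabilities\<close>

text \<open>Passes from an index in the sorted list to a position: the labels counted by
  \<open>position a a y\<close> have their values among the first \<open>K\<close> list entries, and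
  \<open>a\<close> is injective.\<close>

lemma position_self_le_if_ge_kth_greatest:
  fixes a :: "real ^ 'c::finite"
  assumes "no_ties a" and "1 \<le> K" and "K \<le> CARD('c)" and "kth_greatest a K \<le> a $ y"
  shows "position a a y \<le> K"
proof -
  define A where "A = {#a $ y. y \<in># mset_set UNIV#}"
  define xs where "xs = rev (sorted_list_of_multiset A)"
  have inj: "inj (($) a)" using assms(1) by (simp add: no_ties_iff_inj)
  have mset: "mset xs = A" by (simp add: xs_def)
  have set: "set xs = range (($) a)"
    using arg_cong[OF mset, of set_mset] by (simp add: A_def)
  have len: "length xs = CARD('c)"
    using arg_cong[OF mset, of size] by (simp add: A_def)
  have sorted: "sorted_wrt (\<ge>) xs"
    by (simp add: xs_def sorted_wrt_rev)
  have "distinct xs"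
    using len set inj by (intro card_distinct) (simp add: card_image)
  have "($) a ` {y'. a $ y \<le> a $ y'} \<subseteq> set (take K xs)"
  proof
    fix v assume "v \<in> ($) a ` {y'. a $ y \<le> a $ y'}"
    then have v: "v \<in> set xs" "xs ! (K - 1) \<le> v"
      using set assms(4) by (auto simp: kth_greatest_def xs_def A_def)
    then obtain i where i: "i < length xs" "v = xs ! i" by (auto simp: in_set_conv_nth)
    have "i < K"
    proof (rule ccontr)
      assume "\<not> i < K"
      then have "K - 1 < i" using assms(2) by simp
      then have "xs ! i \<le> xs ! (K - 1)"
        using sorted i(1) by (auto simp: sorted_wrt_iff_nth_less)
      \<comment> \<open>Index \<open>K - 1\<close> is zero-based and holds the \<open>K\<close>-th
        greatest entry. Sorting and the choice of \<open>v\<close> give both inequalities, against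
        distinctness.\<close>
      then have "xs ! i = xs ! (K - 1)" using v i by simp
      then show False
        using \<open>distinct xs\<close> \<open>K - 1 < i\<close> i(1) by (simp add: nth_eq_iff_index_eq)
    qed
    then show "v \<in> set (take K xs)"
      using i by (auto simp: in_set_conv_nth intro!: exI[of _ i])
  qed
  then have "card (($) a ` {y'. a $ y \<le> a $ y'}) \<le> card (set (take K xs))"
    by (intro card_mono) auto
  also have "\<dots> \<le> K"
    using card_length[of "take K xs"] by simp
  finally show ?thesis
    unfolding position_self using inj by (simp add: card_image inj_on_subset)
qed

text \<open>The ranking is cut at \<open>k\<close>, the position of \<open>y1\<close> under
  \<open>e\<close>. Since \<open>y2\<close> comes later but within the first \<open>K\<close>, the
  top-\<open>k\<close> set shared by \<open>s\<close> and \<open>e\<close> separates the two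
  labels.\<close>

lemma top_ranking_preserving_imp_greater:
  fixes e s :: "real ^ 'c::finite"
  assumes nt: "no_ties e" and rp: "top_ranking_preserving K s e"
    and K: "1 \<le> K" "K \<le> CARD('c)"
    and gt: "e $ y1 > e $ y2" and ge: "e $ y2 \<ge> kth_greatest e K"
  shows "s $ y1 > s $ y2"
proof -
  have inj: "inj (($) e)" using nt by (simp add: no_ties_iff_inj)
  define k where "k = position e e y1"
  have le: "position e e y2 \<le> K"
    using position_self_le_if_ge_kth_greatest[OF nt K ge] .
  have lt: "k < position e e y2"
    unfolding k_def by (rule position_less_if_greater[OF gt])
  have "k \<in> {1..K}"
    using le lt position_ge_1[of e e y1] by (simp add: k_def)
  then have "{y. position e s y \<le> k} = {y. position e e y \<le> k}"
    using rp top_ranking_preserving_iff[OF inj] by blast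
  then have "position e s y \<le> k \<longleftrightarrow> position e e y \<le> k" for y by blast
  then have "position e s y1 \<le> k" "\<not> position e s y2 \<le> k"
    using lt by (auto simp: k_def)
  then have "position e s y1 < position e s y2" by simp
  \<comment> \<open>Equal scores are excluded because the tie would be broken against
    \<open>y1\<close>, which has the larger \<open>e\<close>.\<close>
  then show ?thesis
    using position_less_if_greater[where s = s and ?y1.0 = y2 and ?y2.0 = y1 and e = e]
      position_greater_if_tie[where s = s and ?y1.0 = y1 and ?y2.0 = y2 and e = e] gt
    by (metis linorder_less_linear order_less_asym)
qed

section \<open>Risk as an expectation over the inputs\<close>

lemma borel_measurable_vec_component [measurable]:
  fixes f :: "'x \<Rightarrow> real ^ 'c::finite"
  assumes "f \<in> borel_measurable M"
  shows "(\<lambda>x. f x $ y) \<in> borel_measurable M"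
  using assms by (rule borel_measurable_continuous_on[rotated]) (intro continuous_intros)

lemma measurable_position:
  fixes e s :: "'x \<Rightarrow> real ^ 'c::finite"
  assumes [measurable]: "e \<in> borel_measurable M" "s \<in> borel_measurable M"
  shows "(\<lambda>x. position (e x) (s x) y) \<in> measurable M (count_space UNIV)"
proof -
  define P where "P x y' \<longleftrightarrow> s x $ y' > s x $ y \<or> s x $ y' = s x $ y \<and> e x $ y' \<le> e x $ y" for x y'
  have [measurable]: "Measurable.pred M (\<lambda>x. P x y')" for y'
    unfolding P_def by measurable
  \<comment> \<open>As a finite sum of indicators of measurable predicates, the cardinality is
    measurable.\<close>
  have "position (e x) (s x) y = (\<Sum>y'\<in>UNIV. if P x y' then 1 else 0)" for x
    unfolding position_def P_def[symmetric] by (simp add: sum.If_cases)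
  then show ?thesis by simp
qed

lemma autkc_loss_bounds: "0 \<le> autkc_loss K p" "autkc_loss K p \<le> 1"
proof -
  show "0 \<le> autkc_loss K p" by (simp add: autkc_loss_def sum_nonneg)
  have "(\<Sum>k=1..K. of_bool (p > k)) \<le> (\<Sum>k=1..K. 1 :: real)"
    by (intro sum_mono) auto
  \<comment> \<open>For \<open>K = 0\<close> division by zero makes the loss 0.\<close>
  then show "autkc_loss K p \<le> 1"
    by (cases "K = 0") (auto simp: autkc_loss_def field_simps)
qed

section \<open>Conditioning on the input\<close>

text \<open>A bounded factor depending only on the input can be pulled out of the conditional
  expectation, so under the integral the label indicator may be exchanged for
  \<open>\<eta>\<close>.\<close>

lemma label_cond_prob_integral:
  fixes M :: "'x measure" and D :: "('x \<times> 'c::finite) measure" and h :: "'x \<Rightarrow> real"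
  assumes "prob_space D"
    and sets_D: "sets D = sets (M \<Otimes>\<^sub>M count_space UNIV)"
    and cp: "label_cond_prob M D \<eta>"
    and h [measurable]: "h \<in> borel_measurable M"
    and bound: "\<And>x. \<bar>h x\<bar> \<le> B"
  shows "integrable D (\<lambda>z. h (fst z) * \<eta> (fst z) $ y)"
    and "(\<integral>z. h (fst z) * \<eta> (fst z) $ y \<partial>D) = (\<integral>z. h (fst z) * indicator {y} (snd z) \<partial>D)"
proof -
  interpret prob_space D by fact
  note [measurable_cong] = sets_D
  have [measurable]: "\<eta> \<in> borel_measurable M" using cp by (simp add: label_cond_prob_def)
  define F where "F = vimage_algebra (space D) fst M"
  have fst: "fst \<in> measurable D M" by measurable
  have "subalgebra D F"
    unfolding subalgebra_def F_def using measurable_sets[OF fst]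
    by (auto simp: sets_vimage_algebra2 measurable_space[OF fst])
  then interpret finite_measure_subalgebra D F
    by unfold_locales
  have [measurable]: "fst \<in> measurable F M"
    unfolding F_def by (rule measurable_vimage_algebra1) (use measurable_space[OF fst] in auto)
  have [measurable]: "(\<lambda>z. indicator {y} (snd z) :: real) \<in> borel_measurable D"
    by measurable
  \<comment> \<open>Where the indicator vanishes the bound requires \<open>0 \<le> B\<close>, which
    follows from \<open>\<bar>h x\<bar> \<le> B\<close>.\<close>
  have int: "integrable D (\<lambda>z. h (fst z) * indicator {y} (snd z))"
    by (rule integrable_const_bound[of _ B])
      (use bound in \<open>auto simp: abs_mult indicator_def intro: order_trans[OF abs_ge_zero]\<close>)
  note intg = real_cond_exp_intg[of "\<lambda>z. h (fst z)" "\<lambda>z. indicator {y} (snd z)", OF int]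
  have "AE z in D. \<eta> (fst z) $ y = real_cond_exp D F (\<lambda>z. indicator {y} (snd z)) z"
    using cp by (simp add: label_cond_prob_def F_def)
  then have AE: "AE z in D. h (fst z) * real_cond_exp D F (\<lambda>z. indicator {y} (snd z)) z
      = h (fst z) * \<eta> (fst z) $ y"
    by eventually_elim simp
  show "integrable D (\<lambda>z. h (fst z) * \<eta> (fst z) $ y)"
    by (rule integrable_cong_AE_imp[OF intg(1)]) (use AE in \<open>auto elim: eventually_mono\<close>)
  have "(\<integral>z. h (fst z) * \<eta> (fst z) $ y \<partial>D) =
      (\<integral>z. h (fst z) * real_cond_exp D F (\<lambda>z. indicator {y} (snd z)) z \<partial>D)"
    by (rule integral_cong_AE) (use AE in \<open>auto elim: eventually_mono\<close>)
  also have "\<dots> = (\<integral>z. h (fst z) * indicator {y} (snd z) \<partial>D)"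
    by (rule intg(2)) measurable
  finally show "(\<integral>z. h (fst z) * \<eta> (fst z) $ y \<partial>D) = (\<integral>z. h (fst z) * indicator {y} (snd z) \<partial>D)" .
qed

lemma autkc_risk_eq_integral_cond_autkc_risk:
  fixes M :: "'x measure" and D :: "('x \<times> 'c::finite) measure"
  assumes "prob_space D"
    and sets_D: "sets D = sets (M \<Otimes>\<^sub>M count_space UNIV)"
    and cp: "label_cond_prob M D \<eta>"
    and f [measurable]: "f \<in> borel_measurable M"
  shows "integrable D (\<lambda>z. cond_autkc_risk K (\<eta> (fst z)) (f (fst z)))"
    and "autkc_risk K D \<eta> f = (\<integral>z. cond_autkc_risk K (\<eta> (fst z)) (f (fst z)) \<partial>D)"
proof -
  interpret prob_space D by fact
  note [measurable_cong] = sets_D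
  have \<eta> [measurable]: "\<eta> \<in> borel_measurable M" using cp by (simp add: label_cond_prob_def)
  define h where "h y x = autkc_loss K (position (\<eta> x) (f x) y)" for x y
  have h [measurable]: "h y \<in> borel_measurable M" for y
    unfolding h_def by (rule measurable_compose[OF measurable_position[OF \<eta> f]]) simp
  have bound: "\<bar>h y x\<bar> \<le> 1" for y x
    using autkc_loss_bounds by (simp add: h_def)
  note lcp = label_cond_prob_integral[OF assms(1) sets_D cp h bound]
  have int: "integrable D (\<lambda>z. h y (fst z) * indicator {y} (snd z))" for y
    by (rule integrable_const_bound[of _ 1])
      (use bound in \<open>auto simp: abs_mult indicator_def\<close>)
  show "integrable D (\<lambda>z. cond_autkc_risk K (\<eta> (fst z)) (f (fst z)))"
    unfolding cond_autkc_risk_def h_def[symmetric] by (intro Bochner_Integration.integrable_sum lcp)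
  have "autkc_risk K D \<eta> f = (\<integral>z. h (snd z) (fst z) \<partial>D)"
    unfolding autkc_risk_def h_def autkc_loss_def case_prod_beta by (rule refl)
  \<comment> \<open>Indicators single out the observed label, so each summand becomes a function of
    the input times a label indicator, as conditioning requires.\<close>
  also have "\<dots> = (\<integral>z. (\<Sum>y\<in>UNIV. h y (fst z) * indicator {y} (snd z)) \<partial>D)"
    by (simp add: indicator_def if_distrib[of "\<lambda>x. _ * x"] cong: if_cong)
  also have "\<dots> = (\<Sum>y\<in>UNIV. \<integral>z. h y (fst z) * indicator {y} (snd z) \<partial>D)"
    by (intro Bochner_Integration.integral_sum int)
  also have "\<dots> = (\<Sum>y\<in>UNIV. \<integral>z. h y (fst z) * \<eta> (fst z) $ y \<partial>D)"
    by (simp add: lcp)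
  also have "\<dots> = (\<integral>z. cond_autkc_risk K (\<eta> (fst z)) (f (fst z)) \<partial>D)"
    unfolding cond_autkc_risk_def h_def[symmetric]
    by (intro Bochner_Integration.integral_sum[symmetric] lcp)
  finally show "autkc_risk K D \<eta> f = (\<integral>z. cond_autkc_risk K (\<eta> (fst z)) (f (fst z)) \<partial>D)" .
qed

section \<open>Characterisation of Bayes optimality\<close>

theorem theorem3:
  fixes M :: "'x measure"
    and D :: "('x \<times> 'c::finite) measure"
    and \<eta> f :: "'x \<Rightarrow> real ^ 'c"
    and K :: nat
  assumes "prob_space D"
    and "sets D = sets (M \<Otimes>\<^sub>M count_space UNIV)"
    and "label_cond_prob M D \<eta>"
    and "AE x in distr D M fst. no_ties (\<eta> x)"
    and "K > 0"
    and "f \<in> borel_measurable M"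
  shows "(autkc_bayes_optimal K M D \<eta> f \<longleftrightarrow>
            (AE x in distr D M fst. top_ranking_preserving K (f x) (\<eta> x))) \<and>
         (K \<le> CARD('c) \<longrightarrow> autkc_bayes_optimal K M D \<eta> f \<longrightarrow>
            (AE x in distr D M fst. \<forall>y1 y2.
               \<eta> x $ y1 > \<eta> x $ y2 \<and> \<eta> x $ y2 \<ge> kth_greatest (\<eta> x) K \<longrightarrow>
               f x $ y1 > f x $ y2))"
proof -
  interpret prob_space D by fact
  note [measurable_cong] = assms(2)
  note [measurable] = assms(6)
  have \<eta> [measurable]: "\<eta> \<in> borel_measurable M" using assms(3) by (simp add: label_cond_prob_def)
  have fst: "fst \<in> measurable D M" by measurable
  note risk = autkc_risk_eq_integral_cond_autkc_risk[OF assms(1-3)]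
  have nt: "AE z in D. inj (($) (\<eta> (fst z)))"
    using AE_distrD[OF fst assms(4)] by (simp add: no_ties_iff_inj)
  \<comment> \<open>\<open>\<eta>\<close> is itself an admissible score and minimises the
    conditional risk at almost every input, so the infimum is attained there.\<close>
  have ge: "autkc_risk K D \<eta> \<eta> \<le> autkc_risk K D \<eta> g" if "g \<in> borel_measurable M" for g
    unfolding risk(2)[OF that] risk(2)[OF \<eta>]
    by (rule integral_mono_AE[OF risk(1)[OF \<eta>] risk(1)[OF that]])
      (use nt in eventually_elim, rule cond_autkc_risk_regret(1)[OF _ assms(5)])
  have "(INF g\<in>borel_measurable M. autkc_risk K D \<eta> g) = autkc_risk K D \<eta> \<eta>"
    by (rule cInf_eq_minimum) (use \<eta> ge in auto)
  then have "autkc_bayes_optimal K M D \<eta> f \<longleftrightarrow> autkc_risk K D \<eta> f = autkc_risk K D \<eta> \<eta>"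
    using assms(6) by (simp add: autkc_bayes_optimal_def)
  \<comment> \<open>Integrability of both conditional risks turns equality of risks into a vanishing
    expected regret; the regret is nonnegative, hence zero almost everywhere.\<close>
  also have "\<dots> \<longleftrightarrow> (\<integral>z. cond_autkc_risk K (\<eta> (fst z)) (f (fst z))
      - cond_autkc_risk K (\<eta> (fst z)) (\<eta> (fst z)) \<partial>D) = 0"
    using risk[OF \<eta>] risk[OF assms(6)] by simp
  also have "\<dots> \<longleftrightarrow> (AE z in D. cond_autkc_risk K (\<eta> (fst z)) (f (fst z))
      - cond_autkc_risk K (\<eta> (fst z)) (\<eta> (fst z)) = 0)"
  proof (rule integral_nonneg_eq_0_iff_AE)
    show "AE z in D. 0 \<le> cond_autkc_risk K (\<eta> (fst z)) (f (fst z))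
        - cond_autkc_risk K (\<eta> (fst z)) (\<eta> (fst z))"
      using nt by eventually_elim (simp add: cond_autkc_risk_regret(1)[OF _ assms(5)])
  qed (intro Bochner_Integration.integrable_diff risk(1) \<eta> assms(6))
  also have "\<dots> \<longleftrightarrow> (AE z in D. top_ranking_preserving K (f (fst z)) (\<eta> (fst z)))"
  proof -
    have "AE z in D. cond_autkc_risk K (\<eta> (fst z)) (f (fst z))
        - cond_autkc_risk K (\<eta> (fst z)) (\<eta> (fst z)) = 0 \<longleftrightarrow>
        top_ranking_preserving K (f (fst z)) (\<eta> (fst z))"
      using nt by eventually_elim (simp add: cond_autkc_risk_regret(2)[OF _ assms(5)])
    then show ?thesis by (rule eventually_subst)
  qed
  \<comment> \<open>The transfer to the law of the input rests on measurability of the event: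
    positions are measurable and the quantifiers range over countable types.\<close>
  also have "\<dots> \<longleftrightarrow> (AE x in distr D M fst. top_ranking_preserving K (f x) (\<eta> x))"
  proof (rule AE_distr_iff[OF fst, symmetric])
    have [measurable]: "(\<lambda>x. position (\<eta> x) (f x) y) \<in> measurable M (count_space UNIV)"
      "(\<lambda>x. position (\<eta> x) (\<eta> x) y) \<in> measurable M (count_space UNIV)" for y
      by (intro measurable_position \<eta> assms(6))+
    show "{x \<in> space M. top_ranking_preserving K (f x) (\<eta> x)} \<in> sets M"
      unfolding top_ranking_preserving_def by measurable
  qed
  finally have opt: "autkc_bayes_optimal K M D \<eta> f \<longleftrightarrow>
      (AE x in distr D M fst. top_ranking_preserving K (f x) (\<eta> x))" .
  \<comment> \<open>\<open>K \<le> CARD('c)\<close> makes \<open>kth_greatest (\<eta> x) K\<close>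
    an actual entry of \<open>\<eta> x\<close>.\<close>
  have "AE x in distr D M fst. \<forall>y1 y2.
      \<eta> x $ y1 > \<eta> x $ y2 \<and> \<eta> x $ y2 \<ge> kth_greatest (\<eta> x) K \<longrightarrow> f x $ y1 > f x $ y2"
    if "K \<le> CARD('c)" "autkc_bayes_optimal K M D \<eta> f"
    using assms(4) that(2)[unfolded opt]
    by eventually_elim (use top_ranking_preserving_imp_greater that(1) assms(5) in force)
  then show ?thesis using opt by blast
qed

end
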